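(* Let $\Xi\subset\Sigma$ be the $\mathbb{Z}$-span of all shifted quasi-symmetric functions $\theta_\alpha$. Then $\Xi$ is closed under the coproduct of $\Sigma$, i.e. $\Delta(\Xi)\subset\Xi\otimes\Xi$.
   Context: A composition $\alpha=[\alpha_1,\ldots,\alpha_k]$ of $n$ ($\alpha\vDash n$) is an ordered list of positive integers summing to $n$; $k(\alpha)=k$; the empty composition $0$ is the composition of $0$. $I(\alpha)=\{\alpha_1,\alpha_1+\alpha_2,\ldots,\alpha_1+\cdots+\alpha_{k-1}\}\subset[n-1]$, $A+1=\{a+1:a\in A\}$. $M_\alpha=\sum_{i_1<\cdots<i_k}x_{i_1}^{\alpha_1}\cdots x_{i_k}^{\alpha_k}$, $M_0=1$. $\Sigma$ is the $\mathbb{Z}$-span of all $M_\alpha$, with coproduct $\Delta(M_\alpha)=\sum_{\alpha=\beta\cdot\gamma}M_\beta\otimes M_\gamma$ ($\cdot$ = concatenation, empty pieces allowed). For $\alpha\vDash n$, $\theta_\alpha=\sum_{\beta\vDash n,\ I(\alpha)\subset I(\beta)\cup(I(\beta)+1)}2^{k(\beta)}M_\beta$, $\theta_0=1$. $\theta_\alpha$ with $\alpha\vDash n$ is a shifted quasi-symmetric function if $n\le 1$ or $\alpha_1>1$. *)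

theory Defs
  imports
    "HOL-Library.Poly_Mapping"
    "HOL-Library.Function_Algebras"
    "HOL-Computational_Algebra.Group_Closure"
begin

section \<open>The tensor product of abelian groups\<close>

text \<open>The tensor product over the integers is the free abelian group on pairs modulo the subgroup
  generated by the biadditivity relations; \<open>frag_of\<close> is the basis of the free group.\<close>

definition tensor_relators :: "(('a::ab_group_add \<times> 'b::ab_group_add) \<Rightarrow>\<^sub>0 int) set" where
  "tensor_relators =
     {frag_of (a + a', b) - frag_of (a, b) - frag_of (a', b) | a a' b. True} \<union>
     {frag_of (a, b + b') - frag_of (a, b) - frag_of (a, b') | a b b'. True}"

quotient_type (overloaded) ('a, 'b) tensor =
  "('a::ab_group_add \<times> 'b::ab_group_add) \<Rightarrow>\<^sub>0 int" /
  "\<lambda>x y. x - y \<in> group_closure tensor_relators"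
proof (rule equivpI)
  show "reflp (\<lambda>x y. x - y \<in> group_closure (tensor_relators :: (('a \<times> 'b) \<Rightarrow>\<^sub>0 int) set))"
    by (rule reflpI) simp
  show "symp (\<lambda>x y. x - y \<in> group_closure (tensor_relators :: (('a \<times> 'b) \<Rightarrow>\<^sub>0 int) set))"
    by (rule sympI) (metis group_closure_minus_iff minus_diff_eq)
  show "transp (\<lambda>x y. x - y \<in> group_closure (tensor_relators :: (('a \<times> 'b) \<Rightarrow>\<^sub>0 int) set))"
    by (rule transpI) (drule (1) group_closure_add, simp)
qed

instantiation tensor :: (ab_group_add, ab_group_add) ab_group_add
begin

lift_definition zero_tensor :: "('a, 'b) tensor" is 0 .

lift_definition plus_tensor :: "('a, 'b) tensor \<Rightarrow> ('a, 'b) tensor \<Rightarrow> ('a, 'b) tensor" is "(+)"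
proof -
  fix a b c d :: "('a \<times> 'b) \<Rightarrow>\<^sub>0 int"
  assume "a - b \<in> group_closure tensor_relators" "c - d \<in> group_closure tensor_relators"
  then have "(a - b) + (c - d) \<in> group_closure tensor_relators"
    by (rule group_closure_add)
  also have "(a - b) + (c - d) = (a + c) - (b + d)"
    by (simp add: algebra_simps)
  finally show "(a + c) - (b + d) \<in> group_closure tensor_relators" .
qed

lift_definition minus_tensor :: "('a, 'b) tensor \<Rightarrow> ('a, 'b) tensor \<Rightarrow> ('a, 'b) tensor" is "(-)"
proof -
  fix a b c d :: "('a \<times> 'b) \<Rightarrow>\<^sub>0 int"
  assume "a - b \<in> group_closure tensor_relators" "c - d \<in> group_closure tensor_relators"
  then have "(a - b) - (c - d) \<in> group_closure tensor_relators"
    by (rule group_closure.diff)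
  also have "(a - b) - (c - d) = (a - c) - (b - d)"
    by (simp add: algebra_simps)
  finally show "(a - c) - (b - d) \<in> group_closure tensor_relators" .
qed

lift_definition uminus_tensor :: "('a, 'b) tensor \<Rightarrow> ('a, 'b) tensor" is uminus
proof -
  fix a b :: "('a \<times> 'b) \<Rightarrow>\<^sub>0 int"
  assume "a - b \<in> group_closure tensor_relators"
  then have "- (a - b) \<in> group_closure tensor_relators"
    by (simp only: group_closure_minus_iff)
  then show "- a - - b \<in> group_closure tensor_relators"
    by (simp only: minus_diff_eq) (simp add: algebra_simps)
qed

instance
  by standard (transfer; simp add: algebra_simps)+

end

lift_definition tensor_of :: "'a::ab_group_add \<Rightarrow> 'b::ab_group_add \<Rightarrow> ('a, 'b) tensor"
    (infixr "\<otimes>" 75)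
  is "\<lambda>a b. frag_of (a, b)" .

lemma tensor_of_add_left: "(a + a') \<otimes> b = a \<otimes> b + a' \<otimes> b"
  by transfer
    (rule group_closure.base, simp only: tensor_relators_def diff_diff_eq, blast)

lemma tensor_of_add_right: "a \<otimes> (b + b') = a \<otimes> b + a \<otimes> b'"
  by transfer
    (rule group_closure.base, simp only: tensor_relators_def diff_diff_eq, blast)

text \<open>For subgroups of torsion-free groups, such as those below, the map between the tensor products
  induced by the inclusions is injective, so its image is the tensor product of the subgroups.\<close>

definition tensor_subgroup ::
    "'a::ab_group_add set \<Rightarrow> 'b::ab_group_add set \<Rightarrow> ('a, 'b) tensor set" where
  "tensor_subgroup A B = group_closure {a \<otimes> b | a b. a \<in> A \<and> b \<in> B}"


section \<open>Compositions\<close>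

definition composition :: "nat list \<Rightarrow> bool" where
  "composition \<alpha> \<longleftrightarrow> 0 \<notin> set \<alpha>"

definition compositions :: "nat \<Rightarrow> nat list set" where
  "compositions n = {\<alpha>. composition \<alpha> \<and> sum_list \<alpha> = n}"

definition partial_sums :: "nat list \<Rightarrow> nat set" where
  "partial_sums \<alpha> = {sum_list (take i \<alpha>) | i. 1 \<le> i \<and> i < length \<alpha>}"

lemma finite_compositions: "finite (compositions n)"
proof -
  have "length \<alpha> \<le> sum_list \<alpha>" if "0 \<notin> set \<alpha>" for \<alpha> :: "nat list"
    using that by (induction \<alpha>) auto
  then have "compositions n \<subseteq> {\<alpha>. set \<alpha> \<subseteq> {..n} \<and> length \<alpha> \<le> n}"
    by (auto simp: compositions_def composition_def dest: member_le_sum_list)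
  then show ?thesis
    by (rule finite_subset) (simp add: finite_lists_length_le)
qed


section \<open>Quasi-symmetric functions\<close>

text \<open>A power series with integer coefficients in the variables \<open>x\<^sub>0, x\<^sub>1, x\<^sub>2, \<dots>\<close> is given by its
  coefficients; a monomial is given by its exponents. Addition of series is pointwise.\<close>

type_synonym series = "(nat \<Rightarrow>\<^sub>0 nat) \<Rightarrow> int"

definition monomial :: "nat list \<Rightarrow> nat list \<Rightarrow> (nat \<Rightarrow>\<^sub>0 nat)" where
  "monomial v \<alpha> = (\<Sum>j<length \<alpha>. Poly_Mapping.single (v ! j) (\<alpha> ! j))"

text \<open>The coefficient of a monomial in the formal sum of \<open>x\<^bsub>v\<^sub>1\<^esub>\<^bsup>\<alpha>\<^sub>1\<^esup> \<cdots> x\<^bsub>v\<^sub>k\<^esub>\<^bsup>\<alpha>\<^sub>k\<^esup>\<close> over all \<open>v\<^sub>1 < \<cdots> < v\<^sub>k\<close>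
  is the number of terms that equal it.\<close>

definition M_series :: "nat list \<Rightarrow> series" where
  "M_series \<alpha> m =
     int (card {v. length v = length \<alpha> \<and> sorted_wrt (<) v \<and> monomial v \<alpha> = m})"

typedef qsym = "group_closure (M_series ` Collect composition)"
  morphisms series_of Abs_qsym
  using zero_in_group_closure by blast

setup_lifting type_definition_qsym

instantiation qsym :: ab_group_add
begin

lift_definition zero_qsym :: qsym is 0
  by (rule zero_in_group_closure)

lift_definition plus_qsym :: "qsym \<Rightarrow> qsym \<Rightarrow> qsym" is "(+)"
  by (rule group_closure_add)

lift_definition minus_qsym :: "qsym \<Rightarrow> qsym \<Rightarrow> qsym" is "(-)"
  by (rule group_closure.diff)

lift_definition uminus_qsym :: "qsym \<Rightarrow> qsym" is uminus
  by simp

instance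
  by standard (transfer; simp add: algebra_simps)+

end

lift_definition M :: "nat list \<Rightarrow> qsym" is "\<lambda>\<alpha>. if composition \<alpha> then M_series \<alpha> else 0"
  by (auto intro: group_closure.base)

lift_definition scale_qsym :: "int \<Rightarrow> qsym \<Rightarrow> qsym" is "\<lambda>c f m. c * f m"
proof -
  fix c :: int and f :: series
  assume "f \<in> group_closure (M_series ` Collect composition)" (is "_ \<in> ?G")
  then have nat: "(\<lambda>m. int n * f m) \<in> ?G" for n
  proof (induction n)
    case 0
    have "(\<lambda>m. int 0 * f m) = 0" by auto
    then show ?case by (simp only: zero_in_group_closure)
  next
    case (Suc n)
    have "(\<lambda>m. int (Suc n) * f m) = f + (\<lambda>m. int n * f m)"
      by (auto simp: fun_eq_iff algebra_simps)
    with Suc show ?case by (simp only: group_closure_add)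
  qed
  show "(\<lambda>m. c * f m) \<in> ?G"
  proof (cases "c \<ge> 0")
    case True
    with nat[of "nat c"] show ?thesis by simp
  next
    case False
    then have "(\<lambda>m. c * f m) = - (\<lambda>m. int (nat (- c)) * f m)"
      by (auto simp: fun_eq_iff)
    with nat[of "nat (- c)"] show ?thesis by (simp only: group_closure_minus_iff)
  qed
qed


section \<open>The coproduct\<close>

definition is_coproduct :: "(qsym \<Rightarrow> (qsym, qsym) tensor) \<Rightarrow> bool" where
  "is_coproduct D \<longleftrightarrow>
     (\<forall>f g. D (f + g) = D f + D g) \<and>
     (\<forall>\<alpha>. composition \<alpha> \<longrightarrow> D (M \<alpha>) = (\<Sum>(\<beta>, \<gamma>)\<in>{(\<beta>, \<gamma>). \<alpha> = \<beta> @ \<gamma>}. M \<beta> \<otimes> M \<gamma>))"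

definition coproduct :: "qsym \<Rightarrow> (qsym, qsym) tensor" where
  "coproduct = (THE D. is_coproduct D)"


text \<open>The coproduct is well defined because the \<open>M \<alpha>\<close> form a basis: the monomial with exponents
  \<open>\<alpha>\<^sub>1, \<dots>, \<alpha>\<^sub>k\<close> in the first \<open>k\<close> variables occurs in \<open>M \<alpha>\<close> and in no other \<open>M \<beta>\<close>.\<close>

definition first_monomial :: "nat list \<Rightarrow> (nat \<Rightarrow>\<^sub>0 nat)" where
  "first_monomial \<alpha> = monomial [0..<length \<alpha>] \<alpha>"

lemma lookup_monomial:
  assumes "distinct v" "length v = length \<alpha>" "j < length \<alpha>"
  shows "Poly_Mapping.lookup (monomial v \<alpha>) (v ! j) = \<alpha> ! j"
proof -
  have "Poly_Mapping.lookup (monomial v \<alpha>) (v ! j) = (\<Sum>i<length \<alpha>. if i = j then \<alpha> ! i else 0)"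
    unfolding monomial_def lookup_sum
    by (rule sum.cong)
      (use assms in \<open>auto simp: lookup_single when_def nth_eq_iff_index_eq\<close>)
  with assms show ?thesis by simp
qed

lemma lookup_monomial_notin:
  assumes "length v = length \<alpha>" "x \<notin> set v"
  shows "Poly_Mapping.lookup (monomial v \<alpha>) x = 0"
  unfolding monomial_def lookup_sum
  by (rule sum.neutral) (use assms in \<open>auto simp: lookup_single when_def\<close>)

lemma keys_monomial:
  assumes "distinct v" "length v = length \<alpha>" "composition \<alpha>"
  shows "Poly_Mapping.keys (monomial v \<alpha>) = set v"
proof (intro set_eqI iffI)
  fix x assume "x \<in> Poly_Mapping.keys (monomial v \<alpha>)"
  then show "x \<in> set v"
    using lookup_monomial_notin[OF assms(2)] by (metis in_keys_iff)
next
  fix x assume "x \<in> set v"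
  then obtain j where j: "j < length v" "x = v ! j"
    by (auto simp: in_set_conv_nth)
  with assms have "\<alpha> ! j \<noteq> 0"
    by (metis composition_def nth_mem)
  with j assms show "x \<in> Poly_Mapping.keys (monomial v \<alpha>)"
    by (simp add: in_keys_iff lookup_monomial)
qed

lemma M_series_first_monomial:
  assumes \<alpha>: "composition \<alpha>" and \<beta>: "composition \<beta>"
  shows "M_series \<beta> (first_monomial \<alpha>) = (if \<alpha> = \<beta> then 1 else 0)"
proof -
  let ?V = "{v. length v = length \<beta> \<and> sorted_wrt (<) v \<and> monomial v \<beta> = first_monomial \<alpha>}"
  have v: "v = [0..<length \<alpha>] \<and> \<alpha> = \<beta>" if "v \<in> ?V" for v
  proof -
    from that have len: "length v = length \<beta>" and srt: "sorted_wrt (<) v"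
      and eq: "monomial v \<beta> = first_monomial \<alpha>" by auto
    from srt have dist: "distinct v"
      by (simp add: strict_sorted_iff)
    have "Poly_Mapping.keys (monomial v \<beta>) = set v"
      using dist len \<beta> by (rule keys_monomial)
    moreover have "Poly_Mapping.keys (first_monomial \<alpha>) = set [0..<length \<alpha>]"
      unfolding first_monomial_def using \<alpha> by (intro keys_monomial) auto
    ultimately have "set v = set [0..<length \<alpha>]"
      using eq by simp
    with srt have v: "v = [0..<length \<alpha>]"
      by (intro strict_sorted_equal) auto
    have "\<alpha> = \<beta>"
    proof (rule nth_equalityI)
      show l: "length \<alpha> = length \<beta>" using v len by simp
      fix j assume j: "j < length \<alpha>"
      have "\<alpha> ! j = Poly_Mapping.lookup (first_monomial \<alpha>) ([0..<length \<alpha>] ! j)"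
        unfolding first_monomial_def using j by (subst lookup_monomial) auto
      also have "\<dots> = \<beta> ! j"
        using eq v l j by (metis dist len lookup_monomial)
      finally show "\<alpha> ! j = \<beta> ! j" .
    qed
    with v show ?thesis by simp
  qed
  show ?thesis
  proof (cases "\<alpha> = \<beta>")
    case True
    then have "[0..<length \<alpha>] \<in> ?V"
      by (simp add: first_monomial_def strict_sorted_iff)
    with v have "?V = {[0..<length \<alpha>]}" by blast
    with True show ?thesis by (simp add: M_series_def)
  next
    case False
    with v have "?V = {}" by blast
    with False show ?thesis by (simp only: M_series_def) simp
  qed
qed

lemma finite_first_monomials:
  "f \<in> group_closure (M_series ` Collect composition) \<Longrightarrow>
    finite {\<alpha>. composition \<alpha> \<and> f (first_monomial \<alpha>) \<noteq> 0}"
proof (induction rule: group_closure.induct)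
  case (base f)
  then consider "f = 0" | \<beta> where "composition \<beta>" "f = M_series \<beta>" by auto
  then show ?case
  proof cases
    case 2
    then have "{\<alpha>. composition \<alpha> \<and> f (first_monomial \<alpha>) \<noteq> 0} \<subseteq> {\<beta>}"
      by (auto simp: M_series_first_monomial split: if_splits)
    then show ?thesis by (rule finite_subset) simp
  qed simp
next
  case (diff f g)
  have "{\<alpha>. composition \<alpha> \<and> (f - g) (first_monomial \<alpha>) \<noteq> 0} \<subseteq>
      {\<alpha>. composition \<alpha> \<and> f (first_monomial \<alpha>) \<noteq> 0} \<union>
      {\<alpha>. composition \<alpha> \<and> g (first_monomial \<alpha>) \<noteq> 0}"
    by auto
  with diff.IH show ?case
    by (meson finite_UnI finite_subset)
qed

definition M_coeffs :: "qsym \<Rightarrow> (nat list \<Rightarrow>\<^sub>0 int)" where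
  "M_coeffs f = Abs_poly_mapping (\<lambda>\<alpha>. if composition \<alpha> then series_of f (first_monomial \<alpha>) else 0)"

lemma lookup_M_coeffs:
  "Poly_Mapping.lookup (M_coeffs f) \<alpha> =
     (if composition \<alpha> then series_of f (first_monomial \<alpha>) else 0)"
proof -
  have "{\<alpha>. (if composition \<alpha> then series_of f (first_monomial \<alpha>) else 0) \<noteq> 0} =
      {\<alpha>. composition \<alpha> \<and> series_of f (first_monomial \<alpha>) \<noteq> 0}"
    by auto
  with finite_first_monomials[OF series_of[of f]] show ?thesis
    unfolding M_coeffs_def by (subst Abs_poly_mapping_inverse) auto
qed

lemma M_coeffs_add: "M_coeffs (f + g) = M_coeffs f + M_coeffs g"
  by (rule poly_mapping_eqI) (simp add: lookup_M_coeffs lookup_add plus_qsym.rep_eq)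

lemma M_coeffs_M: "composition \<alpha> \<Longrightarrow> M_coeffs (M \<alpha>) = frag_of \<alpha>"
  by (rule poly_mapping_eqI)
    (auto simp: lookup_M_coeffs lookup_single when_def M.rep_eq M_series_first_monomial)

lemma qsym_induct:
  assumes "P 0" "\<And>\<alpha>. composition \<alpha> \<Longrightarrow> P (M \<alpha>)" "\<And>f g. P f \<Longrightarrow> P g \<Longrightarrow> P (f - g)"
  shows "P f"
proof -
  have "g \<in> group_closure (M_series ` Collect composition) \<Longrightarrow> P (Abs_qsym g)" for g
  proof (induction rule: group_closure.induct)
    case (base g)
    then consider "g = 0" | \<beta> where "composition \<beta>" "g = M_series \<beta>" by auto
    then show ?case
    proof cases
      case 1
      with assms(1) show ?thesis by (simp only: zero_qsym_def)
    next
      case 2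
      with assms(2)[of \<beta>] show ?thesis by (simp add: M_def)
    qed
  next
    case (diff g h)
    then have "Abs_qsym (g - h) = Abs_qsym g - Abs_qsym h"
      by (metis Abs_qsym_inverse minus_qsym.rep_eq series_of_inverse)
    with diff.IH assms(3) show ?case by (simp only:)
  qed
  from this[OF series_of[of f]] show ?thesis by (simp add: series_of_inverse)
qed

lemma finite_splits: "finite {(\<beta>, \<gamma>). \<alpha> = \<beta> @ \<gamma>}"
  for \<alpha> :: "'a list"
proof -
  have "{(\<beta>, \<gamma>). \<alpha> = \<beta> @ \<gamma>} \<subseteq> (\<lambda>i. (take i \<alpha>, drop i \<alpha>)) ` {..length \<alpha>}"
  proof clarify
    fix \<beta> \<gamma> :: "'a list"
    show "(\<beta>, \<gamma>) \<in> (\<lambda>i. (take i (\<beta> @ \<gamma>), drop i (\<beta> @ \<gamma>))) ` {..length (\<beta> @ \<gamma>)}"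
      by (rule image_eqI[of _ _ "length \<beta>"]) auto
  qed
  then show ?thesis by (rule finite_subset) simp
qed

lemma abs_tensor_add: "abs_tensor (x + y) = abs_tensor x + abs_tensor y"
  by (simp add: plus_tensor.abs_eq)

lemma abs_tensor_sum: "abs_tensor (\<Sum>i\<in>A. h i) = (\<Sum>i\<in>A. abs_tensor (h i))"
  by (induction A rule: infinite_finite_induct)
    (auto simp: abs_tensor_add simp flip: zero_tensor_def)

lemma ex1_coproduct: "\<exists>!D. is_coproduct D"
proof -
  define D0 where "D0 = (\<lambda>f. abs_tensor (frag_extend
    (\<lambda>\<alpha>. \<Sum>(\<beta>, \<gamma>)\<in>{(\<beta>, \<gamma>). \<alpha> = \<beta> @ \<gamma>}. frag_of (M \<beta>, M \<gamma>)) (M_coeffs f)))"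
  have D0: "is_coproduct D0"
    unfolding is_coproduct_def
  proof (intro conjI allI impI)
    show "D0 (f + g) = D0 f + D0 g" for f g
      by (simp only: D0_def M_coeffs_add frag_extend_add abs_tensor_add)
    show "D0 (M \<alpha>) = (\<Sum>(\<beta>, \<gamma>)\<in>{(\<beta>, \<gamma>). \<alpha> = \<beta> @ \<gamma>}. M \<beta> \<otimes> M \<gamma>)"
      if "composition \<alpha>" for \<alpha>
      by (simp only: D0_def M_coeffs_M[OF that] frag_extend_of abs_tensor_sum
          tensor_of.abs_eq case_prod_unfold)
  qed
  have diff: "E (f - g) = E f - E g" if "is_coproduct E" for E f g
  proof -
    from that have "E ((f - g) + g) = E (f - g) + E g"
      unfolding is_coproduct_def by blast
    then show ?thesis by simp
  qed
  have zero: "E 0 = 0" if "is_coproduct E" for E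
    using diff[OF that, of 0 0] by simp
  have "D f = D0 f" if D: "is_coproduct D" for D f
  proof (induction f rule: qsym_induct)
    case 1
    show ?case by (simp only: zero[OF D] zero[OF D0])
  next
    case (2 \<alpha>)
    then show ?case using D D0 unfolding is_coproduct_def by simp
  next
    case (3 f g)
    then show ?case by (simp only: diff[OF D] diff[OF D0])
  qed
  then show ?thesis
    by (intro ex1I[of _ D0] D0 ext)
qed

lemma coproduct_add: "coproduct (f + g) = coproduct f + coproduct g"
  and coproduct_M:
    "composition \<alpha> \<Longrightarrow>
      coproduct (M \<alpha>) = (\<Sum>(\<beta>, \<gamma>)\<in>{(\<beta>, \<gamma>). \<alpha> = \<beta> @ \<gamma>}. M \<beta> \<otimes> M \<gamma>)"
  using theI'[OF ex1_coproduct] unfolding coproduct_def is_coproduct_def by blast+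


section \<open>Shifted quasi-symmetric functions\<close>

definition theta :: "nat list \<Rightarrow> qsym" where
  "theta \<alpha> =
     (\<Sum>\<beta> | \<beta> \<in> compositions (sum_list \<alpha>) \<and>
           partial_sums \<alpha> \<subseteq> partial_sums \<beta> \<union> Suc ` partial_sums \<beta>.
        scale_qsym (2 ^ length \<beta>) (M \<beta>))"

definition shifted_qsym :: "qsym set" where
  "shifted_qsym = group_closure {theta \<alpha> | \<alpha>. composition \<alpha> \<and> (sum_list \<alpha> \<le> 1 \<or> hd \<alpha> > 1)}"

end

(* For shifted theta, write S for the set of partial sums of alpha; being shifted means that
   S is contained in {2..<n}. Cutting a composition beta of n at height i into gamma and delta puts
   i, hence also i + 1, into the set that has to cover S, so that the covering condition
   decouples: gamma has to cover the part of S below i and delta the part of S above i + 1, moved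
   down by i. The coproduct is therefore the sum of n + 1 pure tensors of thetas, and both factors
   are shifted because neither set contains 1. *)

theory Submission
  imports Defs HOL.Modules
begin

section \<open>Compositions and their partial sums\<close>

lemma mem_partial_sums:
  "s \<in> partial_sums \<alpha> \<longleftrightarrow> (\<exists>i. 1 \<le> i \<and> i < length \<alpha> \<and> s = sum_list (take i \<alpha>))"
  by (auto simp: partial_sums_def)

lemma partial_sums_Nil [simp]: "partial_sums [] = {}"
  and partial_sums_single [simp]: "partial_sums [x] = {}"
  by (auto simp: partial_sums_def)

text \<open>The cut point \<open>sum_list \<gamma>\<close> is a proper partial sum only if both
  pieces are nonempty; otherwise it would be 0 or the total, which \<open>partial_sums\<close>
  leaves out.\<close>

lemma partial_sums_append:
  assumes "\<gamma> \<noteq> []" "\<delta> \<noteq> []"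
  shows "partial_sums (\<gamma> @ \<delta>) =
    partial_sums \<gamma> \<union> insert (sum_list \<gamma>) ((+) (sum_list \<gamma>) ` partial_sums \<delta>)"
proof (intro set_eqI iffI)
  fix s assume "s \<in> partial_sums (\<gamma> @ \<delta>)"
  then obtain i where i: "1 \<le> i" "i < length \<gamma> + length \<delta>" "s = sum_list (take i (\<gamma> @ \<delta>))"
    by (auto simp: mem_partial_sums)
  consider "i < length \<gamma>" | "i = length \<gamma>" | "i > length \<gamma>" by linarith
  then show "s \<in> partial_sums \<gamma> \<union> insert (sum_list \<gamma>) ((+) (sum_list \<gamma>) ` partial_sums \<delta>)"
  proof cases
    case 1
    with i show ?thesis by (auto simp: mem_partial_sums)
  next
    case 2
    with i show ?thesis by simp
  next
    case 3
    with i have "sum_list (take (i - length \<gamma>) \<delta>) \<in> partial_sums \<delta>"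
      by (auto simp: mem_partial_sums intro!: exI[of _ "i - length \<gamma>"])
    with i 3 show ?thesis by simp
  qed
next
  fix s assume "s \<in> partial_sums \<gamma> \<union> insert (sum_list \<gamma>) ((+) (sum_list \<gamma>) ` partial_sums \<delta>)"
  then consider "s \<in> partial_sums \<gamma>" | "s = sum_list \<gamma>"
    | t where "t \<in> partial_sums \<delta>" "s = sum_list \<gamma> + t" by auto
  then show "s \<in> partial_sums (\<gamma> @ \<delta>)"
  proof cases
    case 1
    then obtain i where "1 \<le> i" "i < length \<gamma>" "s = sum_list (take i \<gamma>)"
      by (auto simp: mem_partial_sums)
    then show ?thesis unfolding mem_partial_sums by (intro exI[of _ i]) simp
  next
    case 2
    with assms show ?thesis
      unfolding mem_partial_sums by (intro exI[of _ "length \<gamma>"]) (auto simp: Suc_le_eq)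
  next
    case 3
    then obtain i where "1 \<le> i" "i < length \<delta>" "t = sum_list (take i \<delta>)"
      by (auto simp: mem_partial_sums)
    with 3 show ?thesis
      unfolding mem_partial_sums by (intro exI[of _ "length \<gamma> + i"]) simp
  qed
qed

lemma composition_append [simp]: "composition (\<gamma> @ \<delta>) \<longleftrightarrow> composition \<gamma> \<and> composition \<delta>"
  by (auto simp: composition_def)

lemma composition_sum_pos: "composition \<alpha> \<Longrightarrow> \<alpha> \<noteq> [] \<Longrightarrow> 0 < sum_list \<alpha>"
  by (cases \<alpha>) (auto simp: composition_def)

text \<open>A proper cut leaves two nonempty compositions, and both have a positive sum.\<close>

lemma partial_sums_bounds:
  assumes "composition \<alpha>" "s \<in> partial_sums \<alpha>"
  shows "0 < s" "s < sum_list \<alpha>"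
proof -
  from assms(2) obtain i where i: "1 \<le> i" "i < length \<alpha>" "s = sum_list (take i \<alpha>)"
    by (auto simp: mem_partial_sums)
  have "composition (take i \<alpha>)" "composition (drop i \<alpha>)"
    using assms(1) by (metis append_take_drop_id composition_append)+
  with i have "0 < sum_list (take i \<alpha>)" "0 < sum_list (drop i \<alpha>)"
    by (auto intro!: composition_sum_pos)
  moreover have "sum_list \<alpha> = sum_list (take i \<alpha>) + sum_list (drop i \<alpha>)"
    by (metis append_take_drop_id sum_list_append)
  ultimately show "0 < s" "s < sum_list \<alpha>" using i by auto
qed

text \<open>The composition is built from its end: the maximum m of S has to be the last partial
  sum, so the last part is n - m, and induction at m supplies the parts before it.\<close>

lemma ex_composition_partial_sums:
  assumes "S \<subseteq> {0<..<n}"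
  shows "\<exists>\<alpha>\<in>compositions n. partial_sums \<alpha> = S"
  using assms
proof (induction n arbitrary: S rule: less_induct)
  case (less n)
  show ?case
  proof (cases "S = {}")
    case True
    \<comment> \<open>\<open>[0]\<close> has a zero part, so size 0 needs the empty list.\<close>
    have "(if n = 0 then [] else [n]) \<in> compositions n"
      by (auto simp: compositions_def composition_def)
    with True show ?thesis by (intro bexI[of _ "if n = 0 then [] else [n]"]) auto
  next
    case False
    have fin: "finite S" using less.prems by (rule finite_subset) simp
    define m where "m = Max S"
    have m: "m \<in> S" "0 < m" "m < n"
      using Max_in[OF fin False] less.prems by (auto simp: m_def)
    have "S - {m} \<subseteq> {0<..<m}"
      using less.prems Max_ge[OF fin] by (force simp: m_def)
    from less.IH[OF m(3) this] obtain \<alpha>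
      where \<alpha>: "\<alpha> \<in> compositions m" "partial_sums \<alpha> = S - {m}" by blast
    from \<alpha>(1) have sum: "sum_list \<alpha> = m" by (simp add: compositions_def)
    with m(2) have "\<alpha> \<noteq> []" by (cases \<alpha>) simp_all
    with sum have "partial_sums (\<alpha> @ [n - m]) = S"
      by (simp add: partial_sums_append \<alpha>(2) insert_absorb[OF m(1)])
    moreover have "\<alpha> @ [n - m] \<in> compositions n"
      using \<alpha>(1) m by (simp add: compositions_def composition_def)
    ultimately show ?thesis by blast
  qed
qed

text \<open>With at most one part both sides hold. Otherwise the sum is at least 2 and the first
  part is the least partial sum, so both sides say that 1 is not a partial sum.\<close>

lemma shifted_iff_partial_sums:
  assumes "composition \<alpha>"
  shows "sum_list \<alpha> \<le> 1 \<or> hd \<alpha> > 1 \<longleftrightarrow> partial_sums \<alpha> \<subseteq> {2..<sum_list \<alpha>}"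
proof (cases "length \<alpha> \<le> 1")
  case True
  then consider "\<alpha> = []" | x where "\<alpha> = [x]"
    by (cases \<alpha>) auto
  then show ?thesis by cases auto
next
  case False
  then obtain x y zs where \<alpha>: "\<alpha> = x # y # zs"
    by (metis One_nat_def le_SucI length_Cons list.size(3) neq_Nil_conv not_less_eq_eq zero_le)
  with assms have pos: "x > 0" "y > 0" by (auto simp: composition_def)
  have x: "x \<in> partial_sums \<alpha>"
    unfolding mem_partial_sums by (rule exI[of _ 1]) (simp add: \<alpha>)
  have ge: "x \<le> s" if "s \<in> partial_sums \<alpha>" for s
  proof -
    from that obtain i where "1 \<le> i" "s = sum_list (take i \<alpha>)"
      by (auto simp: mem_partial_sums)
    then show ?thesis by (cases i) (auto simp: \<alpha>)
  qed
  have "partial_sums \<alpha> \<subseteq> {2..<sum_list \<alpha>}" if "1 < x"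
    using partial_sums_bounds(2)[OF assms] ge that by fastforce
  then show ?thesis using x pos by (force simp: \<alpha>)
qed

text \<open>\<open>M \<beta>\<close> occurs in a theta of the same degree exactly when this set
  contains the partial sums of the index.\<close>

definition cover :: "nat list \<Rightarrow> nat set" where
  "cover \<beta> = partial_sums \<beta> \<union> Suc ` partial_sums \<beta>"

lemma subset_cover_append_iff:
  assumes \<gamma>: "\<gamma> \<in> compositions i" and \<delta>: "\<delta> \<in> compositions j" and S: "S \<subseteq> {2..<i + j}"
  shows "S \<subseteq> cover (\<gamma> @ \<delta>) \<longleftrightarrow>
    S \<inter> {..<i} \<subseteq> cover \<gamma> \<and> {t. 2 \<le> t \<and> i + t \<in> S} \<subseteq> cover \<delta>"
proof -
  have c: "composition \<gamma>" "composition \<delta>" and s: "sum_list \<gamma> = i" "sum_list \<delta> = j"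
    using \<gamma> \<delta> by (auto simp: compositions_def)
  \<comment> \<open>An empty piece contributes no cut point, but then i and i + 1 lie outside S: for
    i = 0 because S starts at 2, for j = 0 because S stays below i. The first case is where the
    absence of 1 from S enters.\<close>
  consider "\<gamma> = []" | "\<delta> = []" | "\<gamma> \<noteq> []" "\<delta> \<noteq> []" by blast
  then show ?thesis
  proof cases
    case 1
    with s have "i = 0" by simp
    with S have "{t. 2 \<le> t \<and> i + t \<in> S} = S" by auto
    with 1 \<open>i = 0\<close> show ?thesis by simp
  next
    case 2
    with s have "j = 0" by simp
    with S have "{t. 2 \<le> t \<and> i + t \<in> S} = {}" "S \<inter> {..<i} = S" by auto
    with 2 show ?thesis by (simp only: append_Nil2) simp
  next
    case 3
    have eq: "cover (\<gamma> @ \<delta>) = cover \<gamma> \<union> {i, Suc i} \<union> (+) i ` cover \<delta>"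
      using 3 s by (auto simp: cover_def partial_sums_append)
    \<comment> \<open>Equality can occur, as the successor of the partial sum i - 1. Together with
      \<open>hi\<close>, the covers of the two pieces can interfere only at i and i + 1, which the
      cut covers anyway.\<close>
    have lo: "x \<le> i" if "x \<in> cover \<gamma>" for x
      using that partial_sums_bounds(2)[OF c(1)] s by (force simp: cover_def)
    have hi: "0 < x" if "x \<in> cover \<delta>" for x
      using that partial_sums_bounds(1)[OF c(2)] by (auto simp: cover_def)
    show ?thesis
    proof (intro iffI conjI subsetI)
      fix x assume "S \<subseteq> cover (\<gamma> @ \<delta>)" "x \<in> S \<inter> {..<i}"
      then show "x \<in> cover \<gamma>" by (auto simp: eq)
    next
      fix x assume "S \<subseteq> cover (\<gamma> @ \<delta>)" "x \<in> {t. 2 \<le> t \<and> i + t \<in> S}"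
      then show "x \<in> cover \<delta>" using lo[of "i + x"] by (auto simp: eq)
    next
      fix x
      assume *: "S \<inter> {..<i} \<subseteq> cover \<gamma> \<and> {t. 2 \<le> t \<and> i + t \<in> S} \<subseteq> cover \<delta>" and x: "x \<in> S"
      consider "x < i" | "x = i \<or> x = Suc i" | t where "x = i + t" "2 \<le> t"
      proof -
        have "x < i \<or> x = i \<or> x = Suc i \<or> x = i + (x - i) \<and> 2 \<le> x - i" by linarith
        with that show thesis by blast
      qed
      then show "x \<in> cover (\<gamma> @ \<delta>)"
        using * x by cases (auto simp: eq)
    qed
  qed
qed


section \<open>Iterated doubling\<close>

text \<open>Tensors carry no scalar multiplication; the powers of two in \<^const>\<open>theta\<close> are moved across the
  tensor sign as iterated doublings.\<close>

abbreviation dblpow :: "nat \<Rightarrow> 'a::ab_group_add \<Rightarrow> 'a" where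
  "dblpow k \<equiv> (\<lambda>x. x + x) ^^ k"

lemma additive_commutes_dblpow: "additive h \<Longrightarrow> h (dblpow k x) = dblpow k (h x)"
  by (induction k) (auto simp: additive.add)

lemma additive_dblpow: "additive (dblpow k)"
proof
  show "dblpow k (x + y) = dblpow k x + dblpow k y" for x y :: 'a
    by (induction k) (auto simp: algebra_simps)
qed

lemma scale_qsym_dblpow: "scale_qsym (2 ^ k) f = dblpow k f"
proof (induction k)
  case 0
  show ?case by simp (transfer, simp)
next
  case (Suc k)
  have "scale_qsym (2 ^ Suc k) f = scale_qsym (2 ^ k) f + scale_qsym (2 ^ k) f"
    by transfer (auto simp: fun_eq_iff)
  with Suc show ?case by simp
qed

lemma additive_coproduct: "additive coproduct"
  by standard (rule coproduct_add)

lemma additive_tensor_left: "additive (\<lambda>a. a \<otimes> b)"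
  by standard (rule tensor_of_add_left)

lemma additive_tensor_right: "additive (\<lambda>b. a \<otimes> b)"
  by standard (rule tensor_of_add_right)

text \<open>Biadditivity lets each doubling act on either factor, so a given number of them can be
  distributed at will.\<close>

lemma dblpow_tensor: "dblpow (k + l) (a \<otimes> b) = dblpow k a \<otimes> dblpow l b"
  by (simp add: add.commute[of k] funpow_add additive_commutes_dblpow[OF additive_tensor_left]
      additive_commutes_dblpow[OF additive_tensor_right])


section \<open>The coproduct of theta\<close>

text \<open>Lengths add under concatenation, so the power of two splits along with the composition,
  and the rescaled basis obeys the same coproduct formula as the \<open>M \<alpha>\<close>.\<close>

lemma coproduct_dblpow_M:
  assumes "composition \<alpha>"
  shows "coproduct (dblpow (length \<alpha>) (M \<alpha>)) =
    (\<Sum>(\<gamma>, \<delta>)\<in>{(\<gamma>, \<delta>). \<alpha> = \<gamma> @ \<delta>}. dblpow (length \<gamma>) (M \<gamma>) \<otimes> dblpow (length \<delta>) (M \<delta>))"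
  unfolding additive_commutes_dblpow[OF additive_coproduct] coproduct_M[OF assms]
    additive.sum[OF additive_dblpow]
  by (rule sum.cong) (auto simp: dblpow_tensor)

text \<open>Indexing by a set instead of a composition suits the cutting argument, which produces
  the index sets of the two factors directly.\<close>

definition theta_set :: "nat \<Rightarrow> nat set \<Rightarrow> qsym" where
  "theta_set n S = (\<Sum>\<beta> | \<beta> \<in> compositions n \<and> S \<subseteq> cover \<beta>. dblpow (length \<beta>) (M \<beta>))"

lemma theta_eq_theta_set: "theta \<alpha> = theta_set (sum_list \<alpha>) (partial_sums \<alpha>)"
  by (simp add: theta_def theta_set_def cover_def scale_qsym_dblpow)

text \<open>Partial sums realize every subset of {1..<n} by a composition of n; the shifted
  compositions are those whose set avoids 1.\<close>

lemma shifted_generators: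
  "{theta \<alpha> | \<alpha>. composition \<alpha> \<and> (sum_list \<alpha> \<le> 1 \<or> hd \<alpha> > 1)} =
    {theta_set n S | n S. S \<subseteq> {2..<n}}"
proof (intro set_eqI iffI)
  fix f assume "f \<in> {theta \<alpha> | \<alpha>. composition \<alpha> \<and> (sum_list \<alpha> \<le> 1 \<or> hd \<alpha> > 1)}"
  then show "f \<in> {theta_set n S | n S. S \<subseteq> {2..<n}}"
    using shifted_iff_partial_sums theta_eq_theta_set by blast
next
  fix f assume "f \<in> {theta_set n S | n S. S \<subseteq> {2..<n}}"
  then obtain n S where f: "f = theta_set n S" and S: "S \<subseteq> {2..<n}" by blast
  from S have "S \<subseteq> {0<..<n}" by auto
  then obtain \<alpha> where \<alpha>: "\<alpha> \<in> compositions n" "partial_sums \<alpha> = S"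
    using ex_composition_partial_sums by blast
  then have "composition \<alpha>" "sum_list \<alpha> \<le> 1 \<or> hd \<alpha> > 1" "f = theta \<alpha>"
    using S f shifted_iff_partial_sums[of \<alpha>] theta_eq_theta_set[of \<alpha>]
    by (auto simp: compositions_def)
  then show "f \<in> {theta \<alpha> | \<alpha>. composition \<alpha> \<and> (sum_list \<alpha> \<le> 1 \<or> hd \<alpha> > 1)}"
    by blast
qed

text \<open>Once the splits of all \<beta> are grouped by the size i of the left piece, the
  admissible pairs for fixed i form a full product, so the sum over them is a single pure
  tensor.\<close>

lemma coproduct_theta_set:
  assumes S: "S \<subseteq> {2..<n}"
  shows "coproduct (theta_set n S) =
    (\<Sum>i\<le>n. theta_set i (S \<inter> {..<i}) \<otimes> theta_set (n - i) {t. 2 \<le> t \<and> i + t \<in> S})"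
proof -
  let ?E = "\<lambda>\<beta>. dblpow (length \<beta>) (M \<beta>)"
  let ?L = "\<lambda>i. {\<gamma>. \<gamma> \<in> compositions i \<and> S \<inter> {..<i} \<subseteq> cover \<gamma>}"
  let ?R = "\<lambda>i. {\<delta>. \<delta> \<in> compositions (n - i) \<and> {t. 2 \<le> t \<and> i + t \<in> S} \<subseteq> cover \<delta>}"
  let ?B = "{\<beta>. \<beta> \<in> compositions n \<and> S \<subseteq> cover \<beta>}"
  have fin: "finite ?B" "finite (?L i)" "finite (?R i)" for i
    using finite_compositions by auto
  have "coproduct (theta_set n S) = (\<Sum>\<beta>\<in>?B. coproduct (?E \<beta>))"
    by (simp add: theta_set_def additive.sum[OF additive_coproduct])
  also have "\<dots> = (\<Sum>\<beta>\<in>?B. \<Sum>(\<gamma>, \<delta>)\<in>{(\<gamma>, \<delta>). \<beta> = \<gamma> @ \<delta>}. ?E \<gamma> \<otimes> ?E \<delta>)"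
    by (rule sum.cong) (auto simp: coproduct_dblpow_M compositions_def)
  also have "\<dots> = (\<Sum>(\<beta>, \<gamma>, \<delta>)\<in>Sigma ?B (\<lambda>\<beta>. {(\<gamma>, \<delta>). \<beta> = \<gamma> @ \<delta>}). ?E \<gamma> \<otimes> ?E \<delta>)"
    by (rule sum.Sigma) (use fin finite_splits in auto)
  \<comment> \<open>The pair (\<gamma>, \<delta>) determines both \<beta> and i, so one may replace
    the other as first component. Goals 2 and 4 say that the two maps land in the right index sets;
    they use the two directions of \<open>subset_cover_append_iff\<close>.\<close>
  also have "\<dots> = (\<Sum>(i, \<gamma>, \<delta>)\<in>Sigma {..n} (\<lambda>i. ?L i \<times> ?R i). ?E \<gamma> \<otimes> ?E \<delta>)"
  proof (rule sum.reindex_bij_witness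
      [of _ "\<lambda>(i, \<gamma>, \<delta>). (\<gamma> @ \<delta>, \<gamma>, \<delta>)" "\<lambda>(\<beta>, \<gamma>, \<delta>). (sum_list \<gamma>, \<gamma>, \<delta>)"], goal_cases)
    case (2 a)
    then obtain \<gamma> \<delta> where a: "a = (\<gamma> @ \<delta>, \<gamma>, \<delta>)"
      and \<beta>: "\<gamma> @ \<delta> \<in> compositions n" "S \<subseteq> cover (\<gamma> @ \<delta>)" by auto
    then have "\<gamma> \<in> compositions (sum_list \<gamma>)" "\<delta> \<in> compositions (n - sum_list \<gamma>)"
      "sum_list \<gamma> \<le> n"
      by (auto simp: compositions_def)
    with \<beta> S subset_cover_append_iff[OF this(1,2), of S] show ?case by (simp add: a)
  next
    case (4 b)
    then obtain i \<gamma> \<delta> where b: "b = (i, \<gamma>, \<delta>)" "i \<le> n" "\<gamma> \<in> ?L i" "\<delta> \<in> ?R i" by auto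
    then have "\<gamma> @ \<delta> \<in> compositions n" by (auto simp: compositions_def)
    with b S subset_cover_append_iff[of \<gamma> i \<delta> "n - i" S] show ?case by simp
  qed (auto simp: compositions_def)
  also have "\<dots> = (\<Sum>i\<le>n. \<Sum>(\<gamma>, \<delta>)\<in>?L i \<times> ?R i. ?E \<gamma> \<otimes> ?E \<delta>)"
    by (rule sum.Sigma[symmetric]) (use fin in auto)
  also have "\<dots> = (\<Sum>i\<le>n. \<Sum>\<gamma>\<in>?L i. \<Sum>\<delta>\<in>?R i. ?E \<gamma> \<otimes> ?E \<delta>)"
    by (simp add: sum.cartesian_product)
  also have "\<dots> = (\<Sum>i\<le>n. theta_set i (S \<inter> {..<i}) \<otimes>
      theta_set (n - i) {t. 2 \<le> t \<and> i + t \<in> S})"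
    unfolding theta_set_def additive.sum[OF additive_tensor_left]
    by (simp only: additive.sum[OF additive_tensor_right])
  finally show ?thesis .
qed

lemma group_closure_sum:
  "(\<And>i. i \<in> I \<Longrightarrow> f i \<in> group_closure A) \<Longrightarrow> sum f I \<in> group_closure A"
  by (induction I rule: infinite_finite_induct) (auto intro: group_closure_add)

theorem theorem3p2:
  shows "coproduct ` shifted_qsym \<subseteq> tensor_subgroup shifted_qsym shifted_qsym"
proof (rule image_subsetI)
  have gen: "theta_set n S \<in> shifted_qsym" if "S \<subseteq> {2..<n}" for n S
    unfolding shifted_qsym_def shifted_generators using that by (blast intro: group_closure.base)
  fix f assume "f \<in> shifted_qsym"
  then show "coproduct f \<in> tensor_subgroup shifted_qsym shifted_qsym"
    unfolding shifted_qsym_def shifted_generators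
  proof (induction rule: group_closure.induct)
    case (base f)
    then consider "f = 0" | n S where "S \<subseteq> {2..<n}" "f = theta_set n S" by auto
    then show ?case
      \<comment> \<open>The unfolding that prepares the induction also affects the tensor factors in
        the goal; here it is reversed.\<close>
      unfolding shifted_generators[symmetric] shifted_qsym_def[symmetric]
    proof cases
      case 1
      then show "coproduct f \<in> tensor_subgroup shifted_qsym shifted_qsym"
        by (simp add: additive.zero[OF additive_coproduct] tensor_subgroup_def)
    next
      case 2
      \<comment> \<open>The left set inherits the lower bound 2 from S; the right one has it by the
        condition on t, and i + t < n bounds it above by n - i.\<close>
      have "theta_set i (S \<inter> {..<i}) \<in> shifted_qsym"
        "theta_set (n - i) {t. 2 \<le> t \<and> i + t \<in> S} \<in> shifted_qsym" for i
        using 2(1) by (intro gen; force)+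
      then show "coproduct f \<in> tensor_subgroup shifted_qsym shifted_qsym"
        unfolding 2(2) coproduct_theta_set[OF 2(1)] tensor_subgroup_def
        by (intro group_closure_sum group_closure.base) blast
    qed
  next
    case (diff f g)
    then show ?case
      by (simp only: additive.diff[OF additive_coproduct] tensor_subgroup_def group_closure.diff)
  qed
qed

end
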